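(* Let $Q\in\mathcal{M}_n$. Then $z^*=z_{\mathrm{SPN}}$, where $$z^*=\min\{x^\top Q x : x\in\Delta^n\}\quad\text{and}\quad z_{\mathrm{SPN}}=\max\{\lambda\in\mathbb{R} : Q-\lambda E\in\mathcal{SPN}_n\}.$$
   Context: $\mathcal{S}^n$ is the set of real symmetric $n\times n$ matrices, $\Delta^n=\{x\in\mathbb{R}^n : x\ge 0,\ \sum_i x_i=1\}$ is the standard simplex, and $E$ is the $n\times n$ all-ones matrix. $\mathcal{SPN}_n\subseteq\mathcal{S}^n$ is the cone of matrices that are the sum of a symmetric positive semidefinite matrix and a symmetric entrywise nonnegative matrix. $\mathcal{M}_n=\{A=(a_{i,j})\in\mathcal{S}^n : a_{i,j}\le a_{k,\ell} \text{ whenever } i\le k,\ j\le \ell,\ i\neq j,\ k\neq \ell\}$. *)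

theory Defs
  imports "HOL-Analysis.Analysis"
begin

text \<open>Matrices of order \<open>n\<close> have type \<open>real^'n^'n\<close>. Where the order of the indices matters, \<open>'n\<close> is
  a finite linearly ordered type; its elements in increasing order stand for \<open>1, ..., n\<close>.\<close>

definition sym_mats :: "(real^'n^'n) set" where
  "sym_mats = {A. transpose A = A}"

definition std_simplex :: "(real^'n) set" where
  "std_simplex = {x. (\<forall>i. 0 \<le> x $ i) \<and> (\<Sum>i\<in>UNIV. x $ i) = 1}"

definition all_ones :: "real^'n^'n" where
  "all_ones = (\<chi> i j. 1)"

definition psd_mats :: "(real^'n^'n) set" where
  "psd_mats = {A \<in> sym_mats. \<forall>x. 0 \<le> x \<bullet> (A *v x)}"

definition nonneg_mats :: "(real^'n^'n) set" where
  "nonneg_mats = {A \<in> sym_mats. \<forall>i j. 0 \<le> A $ i $ j}"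

definition SPN :: "(real^'n^'n) set" where
  "SPN = {P + N | P N. P \<in> psd_mats \<and> N \<in> nonneg_mats}"

text \<open>Only off-diagonal entries are compared; the diagonal is unconstrained.\<close>

definition monotone_mats :: "(real^'n::{finite,linorder}^'n::{finite,linorder}) set" where
  "monotone_mats = {A \<in> sym_mats. \<forall>i j k l.
     i \<le> k \<and> j \<le> l \<and> i \<noteq> j \<and> k \<noteq> l \<longrightarrow> A $ i $ j \<le> A $ k $ l}"

definition simplex_values :: "real^'n^'n \<Rightarrow> real set" where
  "simplex_values Q = {x \<bullet> (Q *v x) | x. x \<in> std_simplex}"

definition SPN_bounds :: "real^'n^'n \<Rightarrow> real set" where
  "SPN_bounds Q = {r. Q - r *\<^sub>R all_ones \<in> SPN}"

text \<open>\<open>LEAST\<close> and \<open>GREATEST\<close> are arbitrary when no least or greatest element exists, so that a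
  minimum or maximum is attained has to be stated separately, by \<open>is_least\<close> and \<open>is_greatest\<close>.\<close>

definition z_star :: "real^'n^'n \<Rightarrow> real" where
  "z_star Q = (LEAST v. v \<in> simplex_values Q)"

definition z_SPN :: "real^'n^'n \<Rightarrow> real" where
  "z_SPN Q = (GREATEST v. v \<in> SPN_bounds Q)"

definition is_least :: "real set \<Rightarrow> real \<Rightarrow> bool" where
  "is_least S m \<longleftrightarrow> m \<in> S \<and> (\<forall>y\<in>S. m \<le> y)"

definition is_greatest :: "real set \<Rightarrow> real \<Rightarrow> bool" where
  "is_greatest S m \<longleftrightarrow> m \<in> S \<and> (\<forall>y\<in>S. y \<le> m)"

end

theory Submission
  imports Defs
begin

text \<open>Weak duality is immediate: if \<open>Q - r E\<close> is the sum of a positive semidefinite and a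
  nonnegative matrix, then \<open>0 \<le> x\<^sup>T (Q - r E) x = x\<^sup>T Q x - r\<close> on the simplex. Since subtracting a
  multiple of \<open>E\<close> preserves monotonicity, and \<open>Q - z\<^sup>* E\<close> is copositive, everything else follows
  from the fact that a copositive matrix \<open>A\<close> in \<open>\<M>\<^sub>n\<close> lies in \<open>\<S>\<P>\<N>\<^sub>n\<close>
  (\<open>copositive_monotone_decomposition\<close>). This is shown by induction on the order \<open>n\<close>, with two
  reductions.

  If all off-diagonal entries of the last row and column are nonnegative, they go to the nonnegative summand, \<open>a\<^sub>n\<^sub>n \<ge> 0\<close> goes to the semidefinite one, and the
  leading principal submatrix of order \<open>n - 1\<close> is again copositive and monotone.

  Otherwise \<open>a\<^sub>1\<^sub>n\<close>, the least of those entries, is negative. It is also the largest off-diagonal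
  entry of the first row, so these are all negative, and copositivity forces \<open>a\<^sub>1\<^sub>1 > 0\<close>. Completing the square in \<open>x\<^sub>1\<close> leaves the Schur complement
  \<open>b\<^sub>j\<^sub>k = a\<^sub>j\<^sub>k - a\<^sub>1\<^sub>j a\<^sub>1\<^sub>k / a\<^sub>1\<^sub>1\<close>. Because \<open>a\<^sub>1\<^sub>j \<le> 0\<close> for \<open>j > 1\<close>, the square vanishes at some
  \<open>x\<^sub>1 \<ge> 0\<close> whenever the other variables are nonnegative, so \<open>b\<close> is copositive; by the same sign
  condition \<open>b\<close> is monotone. A nonnegative summand for \<open>b\<close>, bordered by zeros, serves for \<open>a\<close>.\<close>

section \<open>Quadratic forms on a finite index set\<close>

text \<open>The quadratic form of the principal submatrix of \<open>a\<close> with index set \<open>S\<close>. Matrices are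
  represented as functions here, so that an induction can run over \<open>S\<close> within one index type.\<close>

definition quad_form :: "'i set \<Rightarrow> ('i \<Rightarrow> 'i \<Rightarrow> real) \<Rightarrow> ('i \<Rightarrow> real) \<Rightarrow> real" where
  "quad_form S a x = (\<Sum>i\<in>S. \<Sum>j\<in>S. a i j * x i * x j)"

text \<open>Copositivity of the principal submatrix of \<open>a\<close> with index set \<open>S\<close>; the values of \<open>x\<close> outside
  \<open>S\<close> do not matter.\<close>

definition copositive_on :: "'i set \<Rightarrow> ('i \<Rightarrow> 'i \<Rightarrow> real) \<Rightarrow> bool" where
  "copositive_on S a \<longleftrightarrow> (\<forall>x. (\<forall>i. 0 \<le> x i) \<longrightarrow> 0 \<le> quad_form S a x)"

text \<open>The condition defining \<open>\<M>\<^sub>n\<close>, for the principal submatrix of \<open>a\<close> with index set \<open>S\<close>.\<close>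

definition offdiag_mono_on :: "'i::linorder set \<Rightarrow> ('i \<Rightarrow> 'i \<Rightarrow> real) \<Rightarrow> bool" where
  "offdiag_mono_on S a \<longleftrightarrow> (\<forall>i\<in>S. \<forall>j\<in>S. \<forall>k\<in>S. \<forall>l\<in>S.
     i \<le> k \<and> j \<le> l \<and> i \<noteq> j \<and> k \<noteq> l \<longrightarrow> a i j \<le> a k l)"

lemma offdiag_mono_onD:
  assumes "offdiag_mono_on S a" "i \<in> S" "j \<in> S" "k \<in> S" "l \<in> S"
    and "i \<le> k" "j \<le> l" "i \<noteq> j" "k \<noteq> l"
  shows "a i j \<le> a k l"
  using assms unfolding offdiag_mono_on_def by blast

lemma offdiag_mono_on_subset:
  "offdiag_mono_on S a \<Longrightarrow> T \<subseteq> S \<Longrightarrow> offdiag_mono_on T a"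
  unfolding offdiag_mono_on_def by blast

lemma quad_form_cong:
  assumes "\<And>i j. i \<in> S \<Longrightarrow> j \<in> S \<Longrightarrow> a i j = b i j" "\<And>i. i \<in> S \<Longrightarrow> x i = y i"
  shows "quad_form S a x = quad_form S b y"
  unfolding quad_form_def using assms by (intro sum.cong) auto

lemma quad_form_eq_0: "(\<And>i. i \<in> S \<Longrightarrow> x i = 0) \<Longrightarrow> quad_form S a x = 0"
  unfolding quad_form_def by simp

lemma quad_form_insert:
  assumes "finite T" "l \<notin> T" and sym: "\<And>i j. a i j = a j i"
  shows "quad_form (insert l T) a x
           = a l l * (x l)\<^sup>2 + 2 * x l * (\<Sum>j\<in>T. a l j * x j) + quad_form T a x"
proof -
  have row: "(\<Sum>j\<in>T. a l j * x l * x j) = x l * (\<Sum>j\<in>T. a l j * x j)"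
    by (simp add: sum_distrib_left mult_ac)
  have col: "(\<Sum>i\<in>T. a i l * x i * x l) = x l * (\<Sum>j\<in>T. a l j * x j)"
    by (simp add: sum_distrib_left mult_ac sym[of _ l])
  have "quad_form (insert l T) a x = a l l * x l * x l + (\<Sum>j\<in>T. a l j * x l * x j)
          + ((\<Sum>i\<in>T. a i l * x i * x l) + quad_form T a x)"
    using assms(1,2) by (simp add: quad_form_def sum.distrib)
  then show ?thesis
    unfolding row col by (simp add: power2_eq_square)
qed

lemma quad_form_rank_one_update:
  "quad_form T (\<lambda>j k. a j k - c j * c k / d) x
     = quad_form T a x - (\<Sum>j\<in>T. c j * x j)\<^sup>2 / d"
proof -
  have "(\<Sum>j\<in>T. c j * x j)\<^sup>2 / d = (\<Sum>j\<in>T. \<Sum>k\<in>T. c j * c k / d * x j * x k)"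
    by (simp add: power2_eq_square sum_product sum_divide_distrib mult_ac)
  then show ?thesis
    by (simp add: quad_form_def sum_subtractf left_diff_distrib)
qed

lemma quad_form_Schur:
  assumes "finite T" "l \<notin> T" and sym: "\<And>i j. a i j = a j i" and "a l l \<noteq> 0"
  shows "quad_form (insert l T) a x
           = a l l * (x l + (\<Sum>j\<in>T. a l j * x j) / a l l)\<^sup>2
             + quad_form T (\<lambda>j k. a j k - a l j * a l k / a l l) x"
proof -
  have "a l l * (x l + s / a l l)\<^sup>2 = a l l * (x l)\<^sup>2 + 2 * x l * s + s\<^sup>2 / a l l" for s
    using assms(4) by (simp add: power2_eq_square field_simps)
  then show ?thesis
    by (simp add: quad_form_insert[OF assms(1-3)] quad_form_rank_one_update)
qed

section \<open>Copositive monotone matrices\<close>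

lemma copositive_on_remove:
  assumes cop: "copositive_on (insert m T) a"
    and "finite T" "m \<notin> T" and sym: "\<And>i j. a i j = a j i"
  shows "copositive_on T a"
  unfolding copositive_on_def
proof (intro allI impI)
  fix x :: "'a \<Rightarrow> real"
  assume "\<forall>i. 0 \<le> x i"
  then have "0 \<le> quad_form (insert m T) a (x(m := 0))"
    using cop by (simp add: copositive_on_def)
  also have "\<dots> = quad_form T a (x(m := 0))"
    by (simp add: quad_form_insert[OF assms(2-4)])
  also have "\<dots> = quad_form T a x"
    using assms(3) by (intro quad_form_cong) auto
  finally show "0 \<le> quad_form T a x" .
qed

lemma copositive_on_diag_nonneg:
  assumes cop: "copositive_on (insert l T) a"
    and "finite T" "l \<notin> T" and sym: "\<And>i j. a i j = a j i"
  shows "0 \<le> a l l"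
proof -
  let ?x = "\<lambda>i. if i = l then 1 else 0 :: real"
  have zero: "(\<Sum>j\<in>T. a l j * ?x j) = 0" "quad_form T a ?x = 0"
    using assms(3) by (auto intro!: sum.neutral quad_form_eq_0)
  have "0 \<le> quad_form (insert l T) a ?x"
    using cop by (simp add: copositive_on_def)
  then show ?thesis
    unfolding quad_form_insert[OF assms(2-4)] zero by simp
qed

lemma copositive_on_diag_pos:
  assumes cop: "copositive_on S a" and "finite S" "l \<in> S" "m \<in> S" "l \<noteq> m"
    and sym: "\<And>i j. a i j = a j i" and neg: "a l m < 0"
  shows "0 < a l l"
proof (rule ccontr)
  assume "\<not> 0 < a l l"
  define U where "U = S - {l, m}"
  have S: "S = insert l (insert m U)" "S = insert m (insert l U)"
    and U: "finite U" "l \<notin> U" "m \<notin> U" "l \<notin> insert m U" "m \<notin> insert l U"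
    using assms(2-5) by (auto simp: U_def)
  have "0 \<le> a m m" "0 \<le> a l l"
    using copositive_on_diag_nonneg[of m "insert l U" a]
      copositive_on_diag_nonneg[of l "insert m U" a] cop S U sym by auto
  with \<open>\<not> 0 < a l l\<close> have all: "a l l = 0" by simp
  \<comment> \<open>With \<open>a l l = 0\<close> the form at \<open>t e\<^sub>l + e\<^sub>m\<close> is \<open>2 t a\<^sub>l\<^sub>m + a\<^sub>m\<^sub>m\<close>; this \<open>t\<close> gives it the value \<open>-1\<close>.\<close>
  define t where "t = (a m m + 1) / (- 2 * a l m)"
  have "0 \<le> t"
    using \<open>0 \<le> a m m\<close> neg by (simp add: t_def divide_simps)
  let ?x = "\<lambda>i. if i = l then t else if i = m then 1 else 0 :: real"
  have zero: "(\<Sum>j\<in>U. a c j * ?x j) = 0" "quad_form U a ?x = 0" for c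
    using U by (auto intro!: sum.neutral quad_form_eq_0)
  have row: "(\<Sum>j\<in>insert m U. a l j * ?x j) = a l m"
    unfolding sum.insert[OF U(1) U(3)] zero using assms(5) by simp
  have "quad_form S a ?x = 2 * t * a l m + a m m"
    unfolding S(1) quad_form_insert[OF finite.insertI[OF U(1)] U(4) sym]
      quad_form_insert[OF U(1) U(3) sym] row zero
    using all assms(5) by simp
  also have "\<dots> = - 1"
    using neg by (simp add: t_def field_simps)
  finally have "quad_form S a ?x = - 1" .
  moreover have "0 \<le> quad_form S a ?x"
    using cop \<open>0 \<le> t\<close> by (simp add: copositive_on_def)
  ultimately show False by simp
qed

text \<open>The semidefinite summand is not named: it is \<open>a - N\<close>.\<close>

lemma copositive_monotone_decomposition:
  fixes a :: "'i::linorder \<Rightarrow> 'i \<Rightarrow> real"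
  assumes "finite S" "copositive_on S a" "offdiag_mono_on S a" "\<And>i j. a i j = a j i"
  shows "\<exists>N. (\<forall>i j. N i j = N j i) \<and> (\<forall>i\<in>S. \<forall>j\<in>S. 0 \<le> N i j) \<and>
             (\<forall>x. 0 \<le> quad_form S (\<lambda>i j. a i j - N i j) x)"
  using assms
proof (induction "card S" arbitrary: S a)
  case 0
  then show ?case
    by (intro exI[of _ "\<lambda>_ _. 0"]) (simp add: quad_form_def)
next
  case (Suc n)
  note cop = Suc.prems(2) and mono = Suc.prems(3) and sym = Suc.prems(4)
  have "S \<noteq> {}" using Suc.hyps(2) by auto
  define l where "l = Min S"
  define m where "m = Max S"
  have lm: "l \<in> S" "m \<in> S" and le: "\<And>i. i \<in> S \<Longrightarrow> l \<le> i" "\<And>i. i \<in> S \<Longrightarrow> i \<le> m"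
    using Suc.prems(1) \<open>S \<noteq> {}\<close> by (auto simp: l_def m_def)
  show ?case
  proof (cases "\<forall>j\<in>S - {m}. 0 \<le> a m j")
    case True
    define T where "T = S - {m}"
    have T: "S = insert m T" "finite T" "m \<notin> T" "n = card T"
      using lm Suc.prems(1) Suc.hyps(2) by (auto simp: T_def)
    have cop': "copositive_on (insert m T) a" using cop T(1) by simp
    obtain N where N: "\<And>i j. N i j = N j i" "\<And>i j. i \<in> T \<Longrightarrow> j \<in> T \<Longrightarrow> 0 \<le> N i j"
        "\<And>x. 0 \<le> quad_form T (\<lambda>i j. a i j - N i j) x"
      using Suc.hyps(1)[OF T(4) T(2) copositive_on_remove[OF cop' T(2,3) sym]
          offdiag_mono_on_subset[OF mono] sym] T(1) by blast
    define N' where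
      "N' = (\<lambda>i j. if i = m \<and> j = m then 0 else if i = m \<or> j = m then a i j else N i j)"
    have N'sym: "N' i j = N' j i" for i j
      using N(1)[of i j] sym[of i j] by (auto simp: N'_def)
    moreover have "0 \<le> N' i j" if "i \<in> S" "j \<in> S" for i j
      using that N(2)[of i j] True sym[of i m] T by (auto simp: N'_def)
    moreover have "0 \<le> quad_form S (\<lambda>i j. a i j - N' i j) x" for x
    proof -
      have s: "a i j - N' i j = a j i - N' j i" for i j
        by (simp only: sym[of i j] N'sym[of i j])
      have row: "(\<Sum>j\<in>T. (a m j - N' m j) * x j) = 0"
        using T(3) by (auto simp: N'_def intro!: sum.neutral)
      have "quad_form T (\<lambda>i j. a i j - N' i j) x = quad_form T (\<lambda>i j. a i j - N i j) x"
        using T(3) by (intro quad_form_cong) (auto simp: N'_def)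
      moreover have "0 \<le> a m m"
        by (rule copositive_on_diag_nonneg[OF cop' T(2,3) sym])
      ultimately show ?thesis
        unfolding T(1) quad_form_insert[OF T(2,3), of "\<lambda>i j. a i j - N' i j", OF s] row
        using N(3)[of x] by (simp add: N'_def)
    qed
    ultimately show ?thesis by blast
  next
    case False
    then obtain j where j: "j \<in> S" "j \<noteq> m" "a m j < 0" by force
    have "l \<noteq> m"
      using le[OF j(1)] j(2) by auto
    have lneg: "a l k < 0" if "k \<in> S" "k \<noteq> l" for k
    proof -
      have "a l k \<le> a j m"
        using offdiag_mono_onD[OF mono lm(1) that(1) j(1) lm(2)] le j that by auto
      then show ?thesis using j(3) sym[of j m] by simp
    qed
    have d: "0 < a l l"
      using copositive_on_diag_pos[OF cop Suc.prems(1) lm \<open>l \<noteq> m\<close> sym] lneg lm \<open>l \<noteq> m\<close> by auto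
    define T where "T = S - {l}"
    have T: "S = insert l T" "finite T" "l \<notin> T" "n = card T"
      using lm Suc.prems(1) Suc.hyps(2) by (auto simp: T_def)
    define b where "b = (\<lambda>j k. a j k - a l j * a l k / a l l)"
    have bsym: "b i j = b j i" for i j
      using sym[of i j] by (simp add: b_def mult.commute)
    have square: "quad_form S a x
        = a l l * (x l + (\<Sum>j\<in>T. a l j * x j) / a l l)\<^sup>2 + quad_form T b x" for x
      unfolding T(1) b_def using d by (intro quad_form_Schur[OF T(2,3) sym]) simp
    have bcop: "copositive_on T b"
      unfolding copositive_on_def
    proof (intro allI impI)
      fix x :: "'i \<Rightarrow> real"
      assume x: "\<forall>i. 0 \<le> x i"
      \<comment> \<open>The value of the eliminated variable at which the completed square vanishes.\<close>
      define t where "t = - (\<Sum>j\<in>T. a l j * x j) / a l l"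
      have "(\<Sum>j\<in>T. a l j * x j) \<le> 0"
      proof (rule sum_nonpos)
        fix j assume "j \<in> T"
        then have "a l j < 0" using lneg T(1,3) by auto
        then show "a l j * x j \<le> 0" using x by (simp add: mult_nonpos_nonneg)
      qed
      then have "0 \<le> t" using d by (simp add: t_def divide_nonpos_pos)
      then have "0 \<le> quad_form S a (x(l := t))"
        using cop x by (simp add: copositive_on_def)
      also have "\<dots> = quad_form T b (x(l := t))"
      proof -
        have "(\<Sum>j\<in>T. a l j * (x(l := t)) j) = (\<Sum>j\<in>T. a l j * x j)"
          using T(3) by (intro sum.cong) auto
        then show ?thesis unfolding square by (simp add: t_def)
      qed
      also have "\<dots> = quad_form T b x"
        using T(3) by (intro quad_form_cong) auto
      finally show "0 \<le> quad_form T b x" .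
    qed
    have bmono: "offdiag_mono_on T b"
      unfolding offdiag_mono_on_def
    proof (intro ballI impI, elim conjE)
      fix i j k h
      assume in_T: "i \<in> T" "j \<in> T" "k \<in> T" "h \<in> T" and o: "i \<le> k" "j \<le> h" "i \<noteq> j" "k \<noteq> h"
      have in_S: "i \<in> S" "j \<in> S" "k \<in> S" "h \<in> S"
        and ne: "i \<noteq> l" "j \<noteq> l" "k \<noteq> l" "h \<noteq> l"
        using in_T T by auto
      have "a i j \<le> a k h"
        using offdiag_mono_onD[OF mono in_S] o by blast
      moreover have "a l i \<le> a l k" "a l j \<le> a l h"
        using offdiag_mono_onD[OF mono lm(1) in_S(1) lm(1) in_S(3)]
          offdiag_mono_onD[OF mono lm(1) in_S(2) lm(1) in_S(4)] o ne by auto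
      then have "(- a l k) * (- a l h) \<le> (- a l i) * (- a l j)"
        using lneg[of i] lneg[of h] in_S ne by (intro mult_mono) auto
      then have "a l k * a l h / a l l \<le> a l i * a l j / a l l"
        using d by (intro divide_right_mono) auto
      ultimately show "b i j \<le> b k h" by (simp add: b_def)
    qed
    obtain N where N: "\<And>i j. N i j = N j i" "\<And>i j. i \<in> T \<Longrightarrow> j \<in> T \<Longrightarrow> 0 \<le> N i j"
        "\<And>x. 0 \<le> quad_form T (\<lambda>i j. b i j - N i j) x"
      using Suc.hyps(1)[OF T(4) T(2) bcop bmono bsym] by blast
    define N' where "N' = (\<lambda>i j. if i = l \<or> j = l then 0 else N i j)"
    have N'sym: "N' i j = N' j i" for i j
      using N(1)[of i j] by (auto simp: N'_def)
    moreover have "0 \<le> N' i j" if "i \<in> S" "j \<in> S" for i j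
      using that N(2)[of i j] T by (auto simp: N'_def)
    moreover have "0 \<le> quad_form S (\<lambda>i j. a i j - N' i j) x" for x
    proof -
      let ?c = "\<lambda>i j. a i j - N' i j"
      have s: "?c i j = ?c j i" for i j
        by (simp only: sym[of i j] N'sym[of i j])
      have "?c l l \<noteq> 0"
        using d by (simp add: N'_def)
      note Schur = quad_form_Schur[OF T(2,3), of ?c, OF s this]
      have "quad_form T (\<lambda>j k. ?c j k - ?c l j * ?c l k / ?c l l) x
          = quad_form T (\<lambda>i j. b i j - N i j) x"
        using T(3) by (intro quad_form_cong) (auto simp: N'_def b_def)
      moreover have "0 \<le> ?c l l"
        using d by (simp add: N'_def)
      ultimately show ?thesis
        unfolding T(1) Schur using N(3)[of x] by simp
    qed
    ultimately show ?thesis by blast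
  qed
qed

section \<open>The standard quadratic program and its relaxation\<close>

lemma inner_matrix_vector_eq_quad_form:
  fixes A :: "real^'n^'n"
  shows "x \<bullet> (A *v x) = quad_form UNIV (\<lambda>i j. A $ i $ j) (\<lambda>i. x $ i)"
  by (simp add: quad_form_def inner_vec_def matrix_vector_mult_def sum_distrib_left mult_ac)

lemma sym_mats_iff: "A \<in> sym_mats \<longleftrightarrow> (\<forall>i j. A $ i $ j = A $ j $ i)"
  by (auto simp: sym_mats_def transpose_def vec_eq_iff)

lemma copositive_monotone_in_SPN:
  fixes A :: "real^'n::{finite,linorder}^'n::{finite,linorder}"
  assumes mono: "A \<in> monotone_mats"
    and cop: "\<And>x. (\<And>i. 0 \<le> x $ i) \<Longrightarrow> 0 \<le> x \<bullet> (A *v x)"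
  shows "A \<in> SPN"
proof -
  let ?a = "\<lambda>i j. A $ i $ j"
  have sym: "?a i j = ?a j i" for i j
    using mono by (simp add: monotone_mats_def sym_mats_iff)
  have "copositive_on UNIV ?a"
    unfolding copositive_on_def
  proof (intro allI impI)
    fix x :: "'n \<Rightarrow> real"
    assume "\<forall>i. 0 \<le> x i"
    then show "0 \<le> quad_form UNIV ?a x"
      using cop[of "\<chi> i. x i"] by (simp add: inner_matrix_vector_eq_quad_form)
  qed
  moreover have "offdiag_mono_on UNIV ?a"
    using mono by (simp add: monotone_mats_def offdiag_mono_on_def)
  ultimately obtain N where N: "\<And>i j. N i j = N j i" "\<And>i j. 0 \<le> N i j"
      "\<And>x. 0 \<le> quad_form UNIV (\<lambda>i j. ?a i j - N i j) x"
    using copositive_monotone_decomposition[of UNIV ?a] sym by auto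
  define M where "M = (\<chi> i j. N i j)"
  have "M \<in> nonneg_mats"
    using N by (auto simp: M_def nonneg_mats_def sym_mats_iff)
  moreover have "x \<bullet> ((A - M) *v x) = quad_form UNIV (\<lambda>i j. ?a i j - N i j) (\<lambda>i. x $ i)" for x
    unfolding inner_matrix_vector_eq_quad_form by (rule quad_form_cong) (auto simp: M_def)
  then have "A - M \<in> psd_mats"
    using N(1,3) sym by (simp add: psd_mats_def sym_mats_iff) (simp add: M_def)
  ultimately show ?thesis
    unfolding SPN_def by force
qed

lemma SPN_copositive:
  assumes "A \<in> SPN" and x: "\<And>i. 0 \<le> x $ i"
  shows "0 \<le> x \<bullet> (A *v x)"
proof -
  obtain P N where A: "A = P + N" and P: "P \<in> psd_mats" and N: "N \<in> nonneg_mats"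
    using assms(1) by (auto simp: SPN_def)
  have "0 \<le> x \<bullet> (P *v x)"
    using P by (simp add: psd_mats_def)
  moreover have "0 \<le> x \<bullet> (N *v x)"
    unfolding inner_matrix_vector_eq_quad_form quad_form_def
    using N x by (intro sum_nonneg) (simp add: nonneg_mats_def)
  ultimately show ?thesis
    by (simp add: A matrix_vector_mult_add_rdistrib inner_add_right)
qed

lemma quadratic_minus_all_ones:
  fixes Q :: "real^'n^'n"
  shows "x \<bullet> ((Q - r *\<^sub>R all_ones) *v x) = x \<bullet> (Q *v x) - r * (\<Sum>i\<in>UNIV. x $ i)\<^sup>2"
proof -
  have "(r *\<^sub>R all_ones :: real^'n^'n) *v x = r *\<^sub>R (\<chi> i. \<Sum>j\<in>UNIV. x $ j)"
    by (simp add: vec_eq_iff matrix_vector_mult_def all_ones_def sum_distrib_left)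
  then show ?thesis
    by (simp add: matrix_vector_mult_diff_rdistrib inner_diff_right inner_vec_def
        power2_eq_square sum_distrib_right right_diff_distrib sum_subtractf
        sum_distrib_left[of r] mult.left_commute[of r])
qed

lemma monotone_mats_minus_all_ones:
  "Q \<in> monotone_mats \<Longrightarrow> Q - r *\<^sub>R all_ones \<in> monotone_mats"
  by (simp add: monotone_mats_def sym_mats_iff all_ones_def)

lemma compact_std_simplex: "compact (std_simplex :: (real^'n) set)"
proof -
  have "std_simplex \<subseteq> cball (0 :: real^'n) 1"
  proof
    fix x :: "real^'n"
    assume "x \<in> std_simplex"
    then have "(\<Sum>i\<in>UNIV. \<bar>x $ i\<bar>) = 1" by (simp add: std_simplex_def)
    then show "x \<in> cball 0 1" using norm_le_l1_cart[of x] by simp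
  qed
  moreover have "closed (std_simplex :: (real^'n) set)"
    unfolding std_simplex_def
    by (intro closed_Collect_conj closed_Collect_all closed_Collect_le closed_Collect_eq
        continuous_intros)
  ultimately show ?thesis
    using bounded_cball bounded_subset compact_eq_bounded_closed by blast
qed

lemma std_simplex_nonempty: "(std_simplex :: (real^'n) set) \<noteq> {}"
proof -
  have "axis undefined 1 \<in> (std_simplex :: (real^'n) set)"
    by (simp add: std_simplex_def axis_def)
  then show ?thesis by blast
qed

text \<open>Homogeneity: a lower bound on the simplex gives a copositive matrix.\<close>

lemma copositive_if_lower_bound:
  fixes Q :: "real^'n^'n"
  assumes low: "\<And>y. y \<in> std_simplex \<Longrightarrow> z \<le> y \<bullet> (Q *v y)" and x: "\<And>i. 0 \<le> x $ i"
  shows "0 \<le> x \<bullet> ((Q - z *\<^sub>R all_ones) *v x)"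
proof (cases "(\<Sum>i\<in>UNIV. x $ i) = 0")
  case True
  then have "x = 0"
    using x by (simp add: vec_eq_iff sum_nonneg_eq_0_iff)
  then show ?thesis by simp
next
  case False
  define s where "s = (\<Sum>i\<in>UNIV. x $ i)"
  have s: "0 < s"
    using False sum_nonneg[of UNIV "\<lambda>i. x $ i"] x by (simp add: s_def less_le)
  define y where "y = (1 / s) *\<^sub>R x"
  have "(\<Sum>i\<in>UNIV. y $ i) = s / s"
    by (simp add: y_def s_def flip: sum_divide_distrib)
  then have "y \<in> std_simplex"
    using s x by (simp add: std_simplex_def) (simp add: y_def)
  then have "z \<le> y \<bullet> (Q *v y)" by (rule low)
  moreover have "x = s *\<^sub>R y" using s by (simp add: y_def)
  then have "x \<bullet> (Q *v x) = s\<^sup>2 * (y \<bullet> (Q *v y))"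
    by (simp add: matrix_vector_mult_scaleR power2_eq_square)
  ultimately have "s\<^sup>2 * z \<le> x \<bullet> (Q *v x)"
    by (simp add: mult_left_mono)
  then show ?thesis
    by (simp add: quadratic_minus_all_ones flip: s_def) (simp add: mult.commute)
qed

theorem corollary5p5:
  fixes Q :: "real^'n::{finite,linorder}^'n::{finite,linorder}"
  assumes "Q \<in> monotone_mats"
  shows "is_least (simplex_values Q) (z_star Q) \<and>
         is_greatest (SPN_bounds Q) (z_SPN Q) \<and>
         z_star Q = z_SPN Q"
proof -
  have "continuous_on std_simplex (\<lambda>x. x \<bullet> (Q *v x))"
    by (intro continuous_intros matrix_vector_mult_linear_continuous_on)
  then obtain x where x: "x \<in> std_simplex"
    and min: "\<And>y. y \<in> std_simplex \<Longrightarrow> x \<bullet> (Q *v x) \<le> y \<bullet> (Q *v y)"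
    using continuous_attains_inf[OF compact_std_simplex std_simplex_nonempty] by blast
  define z where "z = x \<bullet> (Q *v x)"
  have least: "is_least (simplex_values Q) z"
    using x min by (auto simp: is_least_def simplex_values_def z_def)
  have "z \<in> SPN_bounds Q"
    using copositive_monotone_in_SPN[OF monotone_mats_minus_all_ones[OF assms]]
      copositive_if_lower_bound[of z Q] min by (simp add: SPN_bounds_def z_def)
  moreover have "r \<le> z" if "r \<in> SPN_bounds Q" for r
    using that x SPN_copositive[of "Q - r *\<^sub>R all_ones" x]
    by (simp add: SPN_bounds_def z_def quadratic_minus_all_ones std_simplex_def)
  ultimately have greatest: "is_greatest (SPN_bounds Q) z"
    by (simp add: is_greatest_def)
  have "z_star Q = z"
    unfolding z_star_def using least by (intro Least_equality) (auto simp: is_least_def)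
  moreover have "z_SPN Q = z"
    unfolding z_SPN_def using greatest by (intro Greatest_equality) (auto simp: is_greatest_def)
  ultimately show ?thesis
    using least greatest by simp
qed

end
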